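(* Let $\mathcal{B}^\bullet_n(P)$ denote the set of t-shelves of size $n\ge1$ having no node with two children whose left child has a smaller label than its right child (i.e. t-shelves avoiding the pattern $P$ given by the size-3 t-shelf with root $1$, left child $2$ and right child $3$). Let $g_{n,k}$ be the number of t-shelves in $\mathcal{B}^\bullet_n(P)$ having exactly $k$ left children. Then $$\sum_{n\ge1}\sum_{k\ge0} g_{n,k}\frac{z^ny^k}{n!} = \frac{-2}{1+y-\sqrt{y^2+1}\,\coth\left(\frac{z\sqrt{y^2+1}}{2}\right)}.$$
   Context: A treeshelf (t-shelf) of size $n\ge 1$ is a rooted binary tree with $n$ nodes labeled bijectively by $\{1,\dots,n\}$ so that labels strictly increase along every path starting at the root, in which every node has at most one left child and at most one right child, and every child (including a child with no sibling) is designated either as the left child or the right child of its parent. A left child is a node that is the left child of its parent; the number of left children of a t-shelf is the number of such nodes. *)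

theory Defs
  imports
    "HOL-Library.Tree"
    "HOL-Computational_Algebra.Computational_Algebra"
begin

(* Label sequences of all descending paths from the root to some node. *)
fun root_paths :: "'a tree \<Rightarrow> 'a list set" where
  "root_paths \<langle>\<rangle> = {}"
| "root_paths \<langle>l, a, r\<rangle> = insert [a] ((#) a ` (root_paths l \<union> root_paths r))"

(* Nodes are the Node constructors; an absent left or right child is a Leaf. *)
definition tshelves :: "nat \<Rightarrow> nat tree set" where
  "tshelves n = {t. size t = n \<and> distinct (inorder t) \<and> set_tree t = {1..n} \<and>
                    (\<forall>p\<in>root_paths t. sorted_wrt (<) p)}"

fun left_children :: "'a tree \<Rightarrow> nat" where
  "left_children \<langle>\<rangle> = 0"
| "left_children \<langle>l, a, r\<rangle> = (if l = \<langle>\<rangle> then 0 else 1) + left_children l + left_children r"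

definition avoids_P :: "'a::linorder tree \<Rightarrow> bool" where
  "avoids_P t \<longleftrightarrow>
     \<not> (\<exists>a l1 b r1 l2 c r2. \<langle>\<langle>l1, b, r1\<rangle>, a, \<langle>l2, c, r2\<rangle>\<rangle> \<in> subtrees t \<and> b < c)"

definition tshelves_P :: "nat \<Rightarrow> nat tree set" where
  "tshelves_P n = {t \<in> tshelves n. avoids_P t}"

definition g :: "nat \<Rightarrow> nat \<Rightarrow> nat" where
  "g n k = card {t \<in> tshelves_P n. left_children t = k}"

text \<open>
  The identity is one of formal series, stated in the field \<open>\<real>((y))((z))\<close>: the inner
  indeterminate of \<^typ>\<open>real fls fls\<close> is \<open>y\<close>, the outer one is \<open>z\<close>.
  Laurent series in \<open>z\<close> are needed because \<open>coth\<close> has a pole at the origin.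
\<close>

(* The formal series cosh (c z), sinh (c z) and coth (c z) in the variable z. *)
definition fps_cosh :: "'a::field_char_0 \<Rightarrow> 'a fps" where
  "fps_cosh c = fps_const (1/2) * (fps_exp c + fps_exp (-c))"

definition fps_sinh :: "'a::field_char_0 \<Rightarrow> 'a fps" where
  "fps_sinh c = fps_const (1/2) * (fps_exp c - fps_exp (-c))"

definition fls_coth :: "'a::field_char_0 \<Rightarrow> 'a fls" where
  "fls_coth c = fps_to_fls (fps_cosh c) / fps_to_fls (fps_sinh c)"

(* The square root of y^2 + 1 with constant coefficient 1, a power series in y. *)
definition sqrt_y2_1 :: "real fls" where
  "sqrt_y2_1 = fps_to_fls (fps_radical root 2 (fps_X\<^sup>2 + 1))"

lemma sqrt_y2_1_squared: "sqrt_y2_1\<^sup>2 = fls_X\<^sup>2 + 1"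
proof -
  have "fps_radical root 2 (fps_X\<^sup>2 + 1 :: real fps) ^ 2 = fps_X\<^sup>2 + 1"
    using power_radical[of "fps_X\<^sup>2 + 1 :: real fps" root 1]
    by (simp add: numeral_2_eq_2)
  then have "fps_to_fls (fps_radical root 2 (fps_X\<^sup>2 + 1 :: real fps) ^ 2) = fps_to_fls (fps_X\<^sup>2 + 1)"
    by simp
  then show ?thesis
    by (simp add: sqrt_y2_1_def fps_to_fls_power fls_plus_const fls_X_conv_shift_1)
qed

end

theory Submission
  imports Defs
begin

text \<open>
  Removing the root of an increasing tree splits its remaining labels into a left part and a
  right part, and avoiding the pattern means that, when both parts are nonempty, the smaller
  minimum lies on the right. Exchanging the two parts shows that exactly half of all splittings
  into two nonempty parts qualify, so the generating function \<open>F\<close> satisfies the Riccati equation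
  \<open>F' = 1 + (1 + y) F + (y / 2) F\<^sup>2\<close> with \<open>F(0) = 0\<close>. The closed form solves the same equation,
  and its coefficients are therefore the weighted tree counts.
\<close>

section \<open>Pattern-avoiding increasing trees on an arbitrary label set\<close>

text \<open>Subtrees of a t-shelf carry arbitrary label sets, so the recursion has to leave the
  intervals \<open>{1..n}\<close>. Distinct labels force the size to be
  \<open>card A\<close>.\<close>

definition trees_P :: "nat set \<Rightarrow> nat tree set" where
  "trees_P A = {t. distinct (inorder t) \<and> set_tree t = A \<and>
                   (\<forall>p\<in>root_paths t. sorted_wrt (<) p) \<and> avoids_P t}"

lemma tshelves_P_eq_trees_P: "tshelves_P n = trees_P {1..n}"
proof -
  have "size t = n" if "distinct (inorder t)" "set_tree t = {1..n}" for t :: "nat tree"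
    using distinct_card[OF that(1)] that(2) by simp
  then show ?thesis
    by (auto simp: tshelves_P_def tshelves_def trees_P_def)
qed

lemma Union_set_root_paths: "(\<Union>p\<in>root_paths t. set p) = set_tree t"
  by (induction t) auto

text \<open>Prefixing \<open>a\<close> to an increasing path requires \<open>a\<close> to lie below
  every entry, and the paths of a subtree together visit all its labels.\<close>

lemma root_paths_sorted_Node:
  "(\<forall>p\<in>root_paths \<langle>l, a, r\<rangle>. sorted_wrt (<) p) \<longleftrightarrow>
     (\<forall>x\<in>set_tree l \<union> set_tree r. a < x) \<and>
     (\<forall>p\<in>root_paths l. sorted_wrt (<) p) \<and> (\<forall>p\<in>root_paths r. sorted_wrt (<) p)"
  by (auto simp flip: Union_set_root_paths)

lemma Min_set_tree_Node:
  fixes a :: "'a::linorder"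
  assumes "\<forall>p\<in>root_paths \<langle>l, a, r\<rangle>. sorted_wrt (<) p"
  shows "Min (set_tree \<langle>l, a, r\<rangle>) = a"
  using assms unfolding root_paths_sorted_Node
  by (intro Min_eqI) (auto intro: less_imp_le)

text \<open>This makes avoidance a condition on the two child labels at each node. The tests for
  leaves guard \<open>value\<close>, which is unspecified on a leaf.\<close>

lemma avoids_P_iff:
  "avoids_P t \<longleftrightarrow> (\<forall>l a r. \<langle>l, a, r\<rangle> \<in> subtrees t \<longrightarrow> l = \<langle>\<rangle> \<or> r = \<langle>\<rangle> \<or> \<not> value l < value r)"
proof -
  have pattern: "(\<exists>l1 b r1 l2 c r2. l = \<langle>l1, b, r1\<rangle> \<and> r = \<langle>l2, c, r2\<rangle> \<and> b < c) \<longleftrightarrow>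
      l \<noteq> \<langle>\<rangle> \<and> r \<noteq> \<langle>\<rangle> \<and> value l < value r" for l r :: "'a tree"
    by (cases l; cases r) auto
  have "avoids_P t \<longleftrightarrow> \<not> (\<exists>l a r. \<langle>l, a, r\<rangle> \<in> subtrees t \<and>
      (\<exists>l1 b r1 l2 c r2. l = \<langle>l1, b, r1\<rangle> \<and> r = \<langle>l2, c, r2\<rangle> \<and> b < c))"
    unfolding avoids_P_def by blast
  then show ?thesis unfolding pattern by blast
qed

lemma avoids_P_Node:
  "avoids_P \<langle>l, a, r\<rangle> \<longleftrightarrow> avoids_P l \<and> avoids_P r \<and>
     (l = \<langle>\<rangle> \<or> r = \<langle>\<rangle> \<or> \<not> value l < value r)"
  unfolding avoids_P_iff subtrees.simps by blast

text \<open>\<open>B\<close> and \<open>C\<close> stand for the label sets of the left and right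
  subtree. The root of an increasing tree is its minimum, so comparing the two child labels means
  comparing minima, which is meaningful only for nonempty parts.\<close>

definition splittable :: "nat set \<Rightarrow> nat set \<Rightarrow> bool" where
  "splittable B C \<longleftrightarrow> B = {} \<or> C = {} \<or> Min C < Min B"

lemma trees_P_empty: "trees_P {} = {\<langle>\<rangle>}"
  by (auto simp: trees_P_def avoids_P_def)

lemma value_eq_Min:
  assumes "t \<in> trees_P A" "A \<noteq> {}"
  shows "value t = Min A"
proof (cases t)
  case (Node l a r)
  then show ?thesis using assms Min_set_tree_Node[of l a r] by (auto simp: trees_P_def)
qed (use assms in \<open>auto simp: trees_P_def\<close>)

lemma Node_in_trees_P_iff:
  assumes "finite A" "A \<noteq> {}"
  shows "\<langle>l, a, r\<rangle> \<in> trees_P A \<longleftrightarrow>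
    a = Min A \<and> (\<exists>B\<subseteq>A - {Min A}. splittable B (A - {Min A} - B) \<and>
                    l \<in> trees_P B \<and> r \<in> trees_P (A - {Min A} - B))"
    (is "?L \<longleftrightarrow> ?R")
proof
  assume L: ?L
  have a: "a = Min A" using value_eq_Min[OF L assms(2)] by simp
  define B C where "B = set_tree l" and "C = set_tree r"
  have C: "C = A - {Min A} - B" and B: "B \<subseteq> A - {Min A}" and disj: "B \<inter> C = {}"
    using L unfolding a B_def C_def by (auto simp: trees_P_def)
  have l: "l \<in> trees_P B" and r: "r \<in> trees_P C"
    using L unfolding trees_P_def B_def C_def
    by (auto simp: avoids_P_Node root_paths_sorted_Node simp del: root_paths.simps)
  have "splittable B C"
  proof (cases "B = {} \<or> C = {}")
    case False
    have "finite B" "finite C" unfolding B_def C_def by auto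
    then have "Min B \<in> B" "Min C \<in> C" using False by auto
    \<comment> \<open>Disjointness excludes equal minima, so the negated inequality from avoidance
      becomes the strict one in \<open>splittable\<close>.\<close>
    then have "Min B \<noteq> Min C" using disj by auto
    moreover have "\<not> Min B < Min C"
      using L False value_eq_Min[OF l] value_eq_Min[OF r]
      by (auto simp: trees_P_def avoids_P_Node B_def C_def)
    ultimately show ?thesis by (auto simp: splittable_def)
  qed (auto simp: splittable_def)
  then show ?R using a B C l r by blast
next
  assume R: ?R
  then obtain B where a: "a = Min A" and B: "B \<subseteq> A - {Min A}"
    and sp: "splittable B (A - {Min A} - B)"
    and l: "l \<in> trees_P B" and r: "r \<in> trees_P (A - {Min A} - B)" by blast
  have sl: "set_tree l = B" and sr: "set_tree r = A - {Min A} - B"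
    using l r by (auto simp: trees_P_def)
  have mA: "Min A \<in> A" using assms by simp
  have "a < x" if "x \<in> A - {Min A}" for x
    using that assms Min_le[of A x] by (auto simp: a order_less_le)
  then have lt: "\<forall>x\<in>set_tree l \<union> set_tree r. a < x"
    using B by (auto simp: sl sr)
  have "l = \<langle>\<rangle> \<or> r = \<langle>\<rangle> \<or> \<not> value l < value r"
    using sp value_eq_Min[OF l] value_eq_Min[OF r] sl sr
    unfolding splittable_def by (metis eq_set_tree_empty less_asym)
  then show ?L
    using l r lt mA B unfolding trees_P_def
    by (auto simp: avoids_P_Node root_paths_sorted_Node a simp del: root_paths.simps)
qed

lemma trees_P_nonempty:
  assumes "finite A" "A \<noteq> {}"
  defines "A' \<equiv> A - {Min A}"
  shows "trees_P A = (\<lambda>(B, l, r). \<langle>l, Min A, r\<rangle>) `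
           (SIGMA B : {B \<in> Pow A'. splittable B (A' - B)}. trees_P B \<times> trees_P (A' - B))"
    (is "_ = ?f ` ?S")
proof (intro set_eqI)
  fix t
  show "t \<in> trees_P A \<longleftrightarrow> t \<in> ?f ` ?S"
  proof (cases t)
    case Leaf
    then show ?thesis using assms(2) by (auto simp: trees_P_def)
  next
    case (Node l a r)
    show ?thesis
      unfolding Node Node_in_trees_P_iff[OF assms(1,2)] A'_def by (auto simp: image_iff)
  qed
qed

lemma finite_trees_P: "finite A \<Longrightarrow> finite (trees_P A)"
proof (induction "card A" arbitrary: A rule: less_induct)
  case less
  show ?case
  proof (cases "A = {}")
    case False
    define A' where "A' = A - {Min A}"
    have "finite (trees_P B)" if "B \<subseteq> A'" for B
    proof (rule less(1))
      have "B \<subset> A" using that False less(2) Min_in[of A] unfolding A'_def by blast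
      then show "card B < card A" using less(2) by (simp add: psubset_card_mono)
      then show "finite B" using \<open>B \<subset> A\<close> less(2) finite_subset by blast
    qed
    then show ?thesis
      using less(2) unfolding trees_P_nonempty[OF less(2) False]
      by (intro finite_imageI finite_SigmaI) (auto simp: A'_def)
  qed (simp add: trees_P_empty)
qed

section \<open>The weighted count and its recurrence\<close>

definition weight_P :: "'a::comm_semiring_1 \<Rightarrow> nat set \<Rightarrow> 'a" where
  "weight_P y A = (\<Sum>t\<in>trees_P A. y ^ left_children t)"

lemma weight_P_empty: "weight_P y {} = 1"
  by (simp add: weight_P_def trees_P_empty)

lemma weight_P_nonempty:
  assumes "finite A" "A \<noteq> {}"
  defines "A' \<equiv> A - {Min A}"
  shows "weight_P y A = (\<Sum>B | B \<subseteq> A' \<and> splittable B (A' - B).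
           (if B = {} then 1 else y) * weight_P y B * weight_P y (A' - B))"
proof -
  let ?f = "\<lambda>(B, l, r). \<langle>l, Min A, r\<rangle>"
  let ?I = "{B \<in> Pow A'. splittable B (A' - B)}"
  let ?S = "SIGMA B : ?I. trees_P B \<times> trees_P (A' - B)"
  have fin: "finite A'" using assms by simp
  \<comment> \<open>\<open>B\<close> is recovered from the tree as the label set of
    \<open>l\<close>, so no tree is counted twice.\<close>
  have inj: "inj_on ?f ?S"
    by (auto simp: inj_on_def trees_P_def)
  have "weight_P y A = (\<Sum>x\<in>?S. y ^ left_children (?f x))"
    unfolding weight_P_def trees_P_nonempty[OF assms(1,2), folded A'_def]
    by (subst sum.reindex[OF inj]) simp
  also have "\<dots> = (\<Sum>B\<in>?I. \<Sum>(l, r)\<in>trees_P B \<times> trees_P (A' - B).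
                     y ^ left_children \<langle>l, Min A, r\<rangle>)"
    using fin by (subst sum.Sigma)
      (auto simp: case_prod_unfold intro!: finite_trees_P intro: finite_subset)
  also have "\<dots> = (\<Sum>B\<in>?I. (if B = {} then 1 else y) * weight_P y B * weight_P y (A' - B))"
  proof (intro sum.cong refl)
    fix B assume "B \<in> ?I"
    have "(\<Sum>(l, r)\<in>trees_P B \<times> trees_P (A' - B). y ^ left_children \<langle>l, Min A, r\<rangle>)
        = (\<Sum>(l, r)\<in>trees_P B \<times> trees_P (A' - B).
            (if B = {} then 1 else y) * (y ^ left_children l * y ^ left_children r))"
      \<comment> \<open>Since \<open>set_tree l = B\<close>, the root has a left child exactly when
        \<open>B\<close> is nonempty; this gives the extra factor \<open>y\<close>.\<close>
      by (intro sum.cong refl) (auto simp: trees_P_def power_add mult_ac split: if_splits)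
    also have "\<dots> = (if B = {} then 1 else y) * (weight_P y B * weight_P y (A' - B))"
      unfolding weight_P_def sum_product sum.cartesian_product
      by (simp only: case_prod_unfold sum_distrib_left)
    finally show "(\<Sum>(l, r)\<in>trees_P B \<times> trees_P (A' - B). y ^ left_children \<langle>l, Min A, r\<rangle>)
        = (if B = {} then 1 else y) * weight_P y B * weight_P y (A' - B)"
      by (simp only: mult.assoc)
  qed
  finally show ?thesis by (simp add: Pow_def)
qed

lemma sum_Pow_card:
  fixes f :: "nat \<Rightarrow> 'a::comm_semiring_1"
  assumes "finite A"
  shows "(\<Sum>B\<in>Pow A. f (card B)) = (\<Sum>k\<le>card A. of_nat (card A choose k) * f k)"
proof -
  have "(\<Sum>B\<in>Pow A. f (card B)) = (\<Sum>k\<le>card A. \<Sum>B | B \<in> Pow A \<and> card B = k. f (card B))"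
    using assms by (intro sum.group[symmetric]) (auto intro: card_mono)
  also have "\<dots> = (\<Sum>k\<le>card A. of_nat (card A choose k) * f k)"
    by (intro sum.cong refl) (simp add: n_subsets[OF assms])
  finally show ?thesis .
qed

text \<open>Complementation preserves the summand and exchanges splittable with non-splittable sets
  among the proper nonempty subsets, so the sum is half of that over all of them. The terms for
  \<open>{}\<close> and \<open>A\<close> contain \<open>v 0 = 0\<close>, which allows the sum to run
  over the whole power set.\<close>

lemma twice_sum_splittable:
  fixes v :: "nat \<Rightarrow> 'a::comm_ring_1"
  assumes "finite A" and v0: "v 0 = 0"
  shows "2 * (\<Sum>B | B \<subseteq> A \<and> B \<noteq> {} \<and> B \<noteq> A \<and> splittable B (A - B).
                v (card B) * v (card (A - B)))
       = (\<Sum>k\<le>card A. of_nat (card A choose k) * (v k * v (card A - k)))"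
proof -
  let ?h = "\<lambda>B. v (card B) * v (card (A - B))"
  let ?P = "{B. B \<subseteq> A \<and> B \<noteq> {} \<and> B \<noteq> A \<and> splittable B (A - B)}"
  let ?Q = "{B. B \<subseteq> A \<and> B \<noteq> {} \<and> B \<noteq> A \<and> \<not> splittable B (A - B)}"
  have dd: "A - (A - B) = B" if "B \<subseteq> A" for B using that by auto
  have anti: "splittable (A - B) B \<longleftrightarrow> \<not> splittable B (A - B)"
    if B: "B \<subseteq> A" "B \<noteq> {}" "B \<noteq> A" for B
  proof -
    have "Min B \<in> B" "Min (A - B) \<in> A - B"
      using B assms(1) by (auto intro!: Min_in intro: finite_subset simp del: Diff_iff)
    then have "Min B \<noteq> Min (A - B)" by auto
    then show ?thesis using B by (auto simp: splittable_def)
  qed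
  have "sum ?h ?P = sum ?h ?Q"
    by (rule sum.reindex_bij_witness[of _ "\<lambda>B. A - B" "\<lambda>B. A - B"])
      (auto simp: dd anti mult.commute)
  then have "2 * sum ?h ?P = sum ?h ?P + sum ?h ?Q" by (simp only: mult_2)
  also have "\<dots> = sum ?h (?P \<union> ?Q)"
    using assms(1) by (intro sum.union_disjoint[symmetric]) auto
  also have "\<dots> = sum ?h (Pow A)"
    using assms by (intro sum.mono_neutral_left) auto
  also have "\<dots> = (\<Sum>B\<in>Pow A. v (card B) * v (card A - card B))"
    using assms(1) by (intro sum.cong refl) (auto simp: card_Diff_subset finite_subset)
  also have "\<dots> = (\<Sum>k\<le>card A. of_nat (card A choose k) * (v k * v (card A - k)))"
    by (rule sum_Pow_card[OF assms(1)])
  finally show ?thesis .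
qed

text \<open>The recurrence sees only the sizes of the parts, so induction on cardinality shows that
  the weight depends on nothing else. Note that \<open>v 0 = 0\<close> while the empty set has
  weight 1: splittings with an empty part are treated separately and produce the linear
  term.\<close>

lemma weight_P_eqI:
  fixes y :: "'a::field_char_0"
  assumes v0: "v 0 = 0" and v1: "v 1 = 1"
    and v_Suc: "\<And>n. n \<ge> 1 \<Longrightarrow> v (Suc n) =
      (1 + y) * v n + y / 2 * (\<Sum>k\<le>n. of_nat (n choose k) * (v k * v (n - k)))"
  shows "finite A \<Longrightarrow> A \<noteq> {} \<Longrightarrow> weight_P y A = v (card A)"
proof (induction "card A" arbitrary: A rule: less_induct)
  case less
  define A' where "A' = A - {Min A}"
  have fin: "finite A'" using less by (simp add: A'_def)
  have card: "card A = Suc (card A')"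
    using less by (simp add: A'_def card_gt_0_iff)
  have IH: "weight_P y B = v (card B)" if "B \<subseteq> A'" "B \<noteq> {}" for B
  proof (rule less(1))
    show "card B < card A" using card_mono[OF fin that(1)] by (simp add: card)
    show "finite B" using that(1) fin by (rule finite_subset)
  qed (rule that(2))
  let ?w = "\<lambda>B. (if B = {} then 1 else y) * weight_P y B * weight_P y (A' - B)"
  let ?P = "{B. B \<subseteq> A' \<and> B \<noteq> {} \<and> B \<noteq> A' \<and> splittable B (A' - B)}"
  have w: "weight_P y A = (\<Sum>B | B \<subseteq> A' \<and> splittable B (A' - B). ?w B)"
    unfolding A'_def by (rule weight_P_nonempty[OF less(2,3)])
  show ?case
  proof (cases "A' = {}")
    case True
    then have "{B. B \<subseteq> A' \<and> splittable B (A' - B)} = {{}}" by (auto simp: splittable_def)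
    then show ?thesis using True v1 by (simp add: w card weight_P_empty)
  next
    case False
    then have n: "card A' \<ge> 1" using fin by (simp add: Suc_le_eq card_gt_0_iff)
    \<comment> \<open>With n = \<open>card A'\<close>, an empty left part contributes
      \<open>v n\<close> and an empty right part \<open>y * v n\<close>. For \<open>A' = {}\<close>
      the two coincide, hence the case distinction.\<close>
    have "{B. B \<subseteq> A' \<and> splittable B (A' - B)} = insert {} (insert A' ?P)"
      by (auto simp: splittable_def)
    then have "weight_P y A = ?w {} + (?w A' + sum ?w ?P)"
      using fin False by (simp add: w)
    also have "sum ?w ?P = y * (\<Sum>B\<in>?P. v (card B) * v (card (A' - B)))"
      unfolding sum_distrib_left
    proof (intro sum.cong refl)
      fix B assume B: "B \<in> ?P"
      then have "A' - B \<noteq> {}" by auto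
      then have "weight_P y (A' - B) = v (card (A' - B))" by (rule IH[OF Diff_subset])
      then show "?w B = y * (v (card B) * v (card (A' - B)))" using B by (simp add: IH mult.assoc)
    qed
    also have "\<dots> = y / 2 * (2 * (\<Sum>B\<in>?P. v (card B) * v (card (A' - B))))" by simp
    also have "\<dots> = y / 2 * (\<Sum>k\<le>card A'. of_nat (card A' choose k) * (v k * v (card A' - k)))"
      by (simp only: twice_sum_splittable[of A' v, OF fin v0])
    finally show ?thesis
      using False by (simp add: card v_Suc[OF n] weight_P_empty IH algebra_simps)
  qed
qed

section \<open>The Riccati equation\<close>

text \<open>The choice \<open>v n = fact n * fps_nth F n\<close> turns the binomial convolution into
  the Cauchy product in \<open>F\<^sup>2\<close>, and comparing coefficients in the differential
  equation gives the recurrence.\<close>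

lemma weight_P_eq_Riccati:
  fixes y :: "'a::field_char_0" and F :: "'a fps"
  assumes F0: "fps_nth F 0 = 0"
    and ode: "fps_deriv F = 1 + fps_const (1 + y) * F + fps_const (y / 2) * F\<^sup>2"
    and A: "finite A" "A \<noteq> {}"
  shows "weight_P y A = fact (card A) * fps_nth F (card A)"
proof (rule weight_P_eqI[of "\<lambda>n. fact n * fps_nth F n", OF _ _ _ A])
  have rec: "of_nat (Suc n) * fps_nth F (Suc n) = (if n = 0 then 1 else 0) + (1 + y) * fps_nth F n
      + y / 2 * (\<Sum>k\<le>n. fps_nth F k * fps_nth F (n - k))" for n
  proof -
    have "fps_nth (F\<^sup>2) n = (\<Sum>k\<le>n. fps_nth F k * fps_nth F (n - k))"
      by (simp add: power2_eq_square fps_mult_nth atLeast0AtMost)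
    then show ?thesis using arg_cong[OF ode, of "\<lambda>f. fps_nth f n"] by simp
  qed
  show "fact 0 * fps_nth F 0 = 0" using F0 by simp
  show "fact 1 * fps_nth F 1 = 1" using rec[of 0] F0 by simp
  fix n :: nat assume n: "n \<ge> 1"
  have "(\<Sum>k\<le>n. of_nat (n choose k) * ((fact k * fps_nth F k) * (fact (n - k) * fps_nth F (n - k))))
      = fact n * (\<Sum>k\<le>n. fps_nth F k * fps_nth F (n - k))"
    unfolding sum_distrib_left
  proof (intro sum.cong refl)
    fix k assume "k \<in> {..n}"
    then have "(fact n :: 'a) = fact k * fact (n - k) * of_nat (n choose k)"
      by (metis atMost_iff binomial_fact_lemma of_nat_fact of_nat_mult)
    then show "of_nat (n choose k) * ((fact k * fps_nth F k) * (fact (n - k) * fps_nth F (n - k)))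
        = fact n * (fps_nth F k * fps_nth F (n - k))"
      by (simp add: mult_ac)
  qed
  moreover have "fact (Suc n) * fps_nth F (Suc n) = fact n * (of_nat (Suc n) * fps_nth F (Suc n))"
    by (simp add: algebra_simps)
  ultimately show "fact (Suc n) * fps_nth F (Suc n) = (1 + y) * (fact n * fps_nth F n) + y / 2 *
      (\<Sum>k\<le>n. of_nat (n choose k) * ((fact k * fps_nth F k) * (fact (n - k) * fps_nth F (n - k))))"
    using n unfolding rec by (simp add: algebra_simps)
qed

section \<open>Formal hyperbolic functions\<close>

lemma fps_deriv_cosh: "fps_deriv (fps_cosh c) = fps_const c * fps_sinh c"
  by (simp add: fps_cosh_def fps_sinh_def algebra_simps flip: fps_const_neg)

lemma fps_deriv_sinh: "fps_deriv (fps_sinh c) = fps_const c * fps_cosh c"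
  by (simp add: fps_cosh_def fps_sinh_def algebra_simps flip: fps_const_neg)

lemma fps_cosh_square_sub_sinh_square: "(fps_cosh c)\<^sup>2 - (fps_sinh c)\<^sup>2 = 1"
proof -
  have "(fps_cosh c)\<^sup>2 - (fps_sinh c)\<^sup>2
      = fps_const (1/2) * fps_const (1/2) * 4 * (fps_exp c * fps_exp (- c))"
    unfolding fps_cosh_def fps_sinh_def by algebra
  also have "fps_exp c * fps_exp (- c) = 1"
    by (simp flip: fps_exp_add_mult)
  also have "fps_const (1/2 :: 'a) * fps_const (1/2) * 4 * 1 = 1"
    by (simp add: fps_numeral_fps_const)
  finally show ?thesis .
qed

lemma fps_cosh_nth_0: "fps_nth (fps_cosh c) 0 = 1"
  by (simp add: fps_cosh_def)

lemma fps_sinh_nth_0: "fps_nth (fps_sinh c) 0 = 0"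
  by (simp add: fps_sinh_def)

lemma fps_sinh_nonzero: "c \<noteq> 0 \<Longrightarrow> fps_sinh c \<noteq> 0"
proof
  assume "c \<noteq> 0" "fps_sinh c = 0"
  moreover have "fps_nth (fps_sinh c) 1 = c" by (simp add: fps_sinh_def)
  ultimately show False by simp
qed

text \<open>The product form \<open>F D = 2 sinh\<close> is the closed form cleared of the pole of \<open>coth\<close>.\<close>

lemma Riccati_solution:
  fixes y s :: "'a::field_char_0" and F :: "'a fps"
  assumes s: "s\<^sup>2 = y\<^sup>2 + 1"
  defines "S \<equiv> fps_sinh (s / 2)" and "C \<equiv> fps_cosh (s / 2)"
  defines "D \<equiv> fps_const s * C - fps_const (1 + y) * S"
  assumes "D \<noteq> 0" and FD: "F * D = 2 * S"
  shows "fps_deriv F = 1 + fps_const (1 + y) * F + fps_const (y / 2) * F\<^sup>2"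
proof -
  define a b h where "a = fps_const s" and "b = fps_const y" and "h = fps_const (1 / 2 :: 'a)"
  \<comment> \<open>One half enters through this ring relation, so that \<open>algebra\<close> can
    treat it as a polynomial hypothesis.\<close>
  have h: "2 * h = 1" by (simp add: h_def fps_numeral_fps_const)
  have half: "fps_const (s / 2) = h * a" "fps_const (y / 2) = h * b" "fps_const (1 + y) = 1 + b"
    by (simp_all add: h_def a_def b_def flip: fps_const_add)
  have a2: "a\<^sup>2 = b\<^sup>2 + 1"
    using s by (simp add: a_def b_def flip: fps_const_add)
  have D: "D = a * C - (1 + b) * S" by (simp add: D_def half a_def)
  have S': "fps_deriv S = h * a * C" and C': "fps_deriv C = h * a * S"
    by (simp_all add: S_def C_def fps_deriv_cosh fps_deriv_sinh half)
  have D': "fps_deriv D = a * (h * a * S) - (1 + b) * (h * a * C)"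
    unfolding D by (simp add: S' C' b_def a_def)
  have CS: "C\<^sup>2 - S\<^sup>2 = 1"
    unfolding C_def S_def by (rule fps_cosh_square_sub_sinh_square)
  have "fps_deriv (F * D) = fps_deriv (2 * S)" by (simp only: FD)
  then have F': "F * fps_deriv D + fps_deriv F * D = 2 * (h * a * C)"
    by (simp add: S' fps_numeral_fps_const)
  \<comment> \<open>Multiply the differentiated product by \<open>D\<close> and replace
    \<open>F * D\<close> by \<open>2 * S\<close>.\<close>
  have "fps_deriv F * D\<^sup>2 = a * C * D - 2 * S * fps_deriv D"
    using F' FD h by algebra
  \<comment> \<open>The mixed terms in \<open>C * S\<close> cancel, leaving
    \<open>a\<^sup>2 * (C\<^sup>2 - S\<^sup>2)\<close>.\<close>
  also have "\<dots> = a\<^sup>2"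
    unfolding D' unfolding D using CS h by algebra
  \<comment> \<open>Complete the square: \<open>D + (1 + b) * S = a * C\<close>, and
    \<open>(1 + b)\<^sup>2 - 2 * b = a\<^sup>2\<close>.\<close>
  also have "\<dots> = D\<^sup>2 + (1 + b) * (2 * S) * D + h * b * (2 * S)\<^sup>2"
    unfolding D using CS h a2 by algebra
  also have "\<dots> = (1 + (1 + b) * F + h * b * F\<^sup>2) * D\<^sup>2"
    unfolding FD[symmetric] by (simp add: algebra_simps power2_eq_square)
  finally show ?thesis using \<open>D \<noteq> 0\<close> by (simp add: half)
qed

section \<open>The generating function\<close>

lemma fps_to_fls_sum: "fps_to_fls (sum f A) = (\<Sum>x\<in>A. fps_to_fls (f x))"
  by (induction A rule: infinite_finite_induct) simp_all

text \<open>Taking the weight at the indeterminate itself collects the trees by their number of left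
  children.\<close>

lemma weight_P_fls_X:
  "weight_P fls_X {1..n} = fps_to_fls (Abs_fps (\<lambda>k. real (g n k)))"
proof -
  have "Abs_fps (\<lambda>k. real (g n k)) = (\<Sum>t\<in>trees_P {1..n}. fps_X ^ left_children t)"
  proof (rule fps_ext)
    fix k
    have "{t \<in> trees_P {1..n}. left_children t = k} = trees_P {1..n} \<inter> {t. k = left_children t}"
      by auto
    then show "fps_nth (Abs_fps (\<lambda>k. real (g n k))) k =
        fps_nth (\<Sum>t\<in>trees_P {1..n}. fps_X ^ left_children t) k"
      by (simp add: g_def tshelves_P_eq_trees_P fps_sum_nth
          sum.If_cases finite_trees_P)
  qed
  then show ?thesis
    by (simp add: weight_P_def fps_to_fls_sum fps_to_fls_power)
qed

theorem theorem7:
  shows "fps_to_fls (Abs_fps (\<lambda>n. if n \<ge> 1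
             then fps_to_fls (Abs_fps (\<lambda>k. real (g n k) / fact n)) else 0))
         = - 2 / (1 + fls_const fls_X - fls_const sqrt_y2_1 * fls_coth (sqrt_y2_1 / 2))"
proof -
  define s y where "s = sqrt_y2_1" and "y = (fls_X :: real fls)"
  have s2: "s\<^sup>2 = y\<^sup>2 + 1" unfolding s_def y_def by (rule sqrt_y2_1_squared)
  have s0: "s \<noteq> 0"
  proof
    assume "s = 0"
    then have "fls_nth (y\<^sup>2 + 1) 0 = 0" using s2 by simp
    then show False by (simp add: y_def fls_X_power_conv_shift_1)
  qed
  define S C where "S = fps_sinh (s / 2)" and "C = fps_cosh (s / 2)"
  define D where "D = fps_const s * C - fps_const (1 + y) * S"
  \<comment> \<open>\<open>D\<close> has constant coefficient \<open>s\<close>, a nonzero element of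
    the coefficient field, so \<open>F\<close> is a genuine power series in z although
    \<open>coth\<close> has a pole.\<close>
  define F where "F = 2 * S * inverse D"
  have D0: "fps_nth D 0 = s"
    by (simp add: D_def S_def C_def fps_cosh_nth_0 fps_sinh_nth_0)
  then have D_nz: "D \<noteq> 0" using s0 by auto
  have FD: "F * D = 2 * S"
    using inverse_mult_eq_1[of D] D0 s0 by (simp add: F_def mult.assoc)
  have F0: "fps_nth F 0 = 0" by (simp add: F_def S_def fps_sinh_nth_0)
  have ode: "fps_deriv F = 1 + fps_const (1 + y) * F + fps_const (y / 2) * F\<^sup>2"
    using Riccati_solution[OF s2] D_nz FD unfolding D_def S_def C_def by blast
  have "(if n \<ge> 1 then fps_to_fls (Abs_fps (\<lambda>k. real (g n k) / fact n)) else 0) = fps_nth F n" for n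
  proof (cases "n \<ge> 1")
    case True
    have "Abs_fps (\<lambda>k. real (g n k) / fact n) = fps_const (1 / fact n) * Abs_fps (\<lambda>k. real (g n k))"
      by (simp add: fps_eq_iff)
    then have "fps_to_fls (Abs_fps (\<lambda>k. real (g n k) / fact n))
        = fls_const (1 / fact n) * weight_P y {1..n}"
      by (simp add: y_def weight_P_fls_X[unfolded One_nat_def] fls_times_fps_to_fls)
    also have "weight_P y {1..n} = fact n * fps_nth F n"
      using weight_P_eq_Riccati[OF F0 ode, of "{1..n}"] True by simp
    also have "fact n = (fls_const (fact n) :: real fls)"
      by (metis fls_of_nat of_nat_fact)
    finally show ?thesis
      using True by (simp add: mult.assoc[symmetric])
  qed (use F0 in \<open>auto simp: not_less_eq_eq\<close>)
  then have "fps_to_fls (Abs_fps (\<lambda>n. if n \<ge> 1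
             then fps_to_fls (Abs_fps (\<lambda>k. real (g n k) / fact n)) else 0)) = fps_to_fls F"
    by (simp add: Abs_fps_inverse fps_nth_inverse)
  also have "\<dots> = - 2 / (1 + fls_const y - fls_const s * fls_coth (s / 2))"
  proof -
    let ?S = "fps_to_fls S" and ?C = "fps_to_fls C" and ?D = "fps_to_fls D"
    have S_nz: "?S \<noteq> 0" and D_nz': "?D \<noteq> 0"
      using fps_sinh_nonzero[of "s / 2"] s0 D_nz by (auto simp: S_def)
    have D: "?D = fls_const s * ?C - (1 + fls_const y) * ?S"
      by (simp add: D_def fls_times_fps_to_fls flip: fls_plus_const)
    have "fps_to_fls F * ?D = 2 * ?S"
      using arg_cong[OF FD, of fps_to_fls] by (simp add: fls_times_fps_to_fls)
    then have "fps_to_fls F = 2 * ?S / ?D" using D_nz' by (simp add: field_simps)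
    \<comment> \<open>The series \<open>S\<close> has zero constant term, so this division takes
      place among Laurent series; it turns \<open>C / S\<close> into \<open>coth\<close>.\<close>
    also have "\<dots> = - 2 / (- (?D / ?S))" using S_nz D_nz' by (simp add: field_simps)
    also have "- (?D / ?S) = 1 + fls_const y - fls_const s * (?C / ?S)"
      unfolding D using S_nz by (simp add: field_simps)
    finally show ?thesis by (simp add: fls_coth_def S_def C_def)
  qed
  finally show ?thesis by (simp only: s_def y_def)
qed

end
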